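(* Let $k \geq 1$ be an integer, let $\Sigma^X, \Sigma^Y \in \mathbb{R}^{k\times k}$ be covariance matrices, and let $X=(X_1,\dots,X_k)$ and $Y=(Y_1,\dots,Y_k)$ be Gaussian random vectors in $\mathbb{R}^k$ with $X \overset{d}{=} N(0,\Sigma^X)$ and $Y \overset{d}{=} N(0,\Sigma^Y)$. Suppose that $$2\,|\Sigma^X_{ij}-\Sigma^Y_{ij}| \leq \Sigma^Y_{ii}-\Sigma^X_{ii}+\Sigma^Y_{jj}-\Sigma^X_{jj} \qquad \text{for all } 1 \leq i,j \leq k.$$ Then for all real $m \geq 1$, $$\mathbb{E}\Big[\big(\max_{1 \leq i \leq k}|X_i|\big)^m\Big] \leq \mathbb{E}\Big[\big(\max_{1 \leq i \leq k}|Y_i|\big)^m\Big].$$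
   Context: $N(0,\Sigma)$ denotes the centered multivariate normal distribution with covariance matrix $\Sigma$ (symmetric positive semidefinite, possibly singular), and $\overset{d}{=}$ denotes equality in distribution. *)

theory Defs
  imports "HOL-Probability.Probability"
begin

definition covariance_matrix :: "real ^ 'n ^ 'n \<Rightarrow> bool" where
  "covariance_matrix S \<longleftrightarrow> transpose S = S \<and> (\<forall>v. 0 \<le> v \<bullet> (S *v v))"

definition std_gaussian :: "(real ^ 'n) measure" where
  "std_gaussian = density lborel (\<lambda>z. ennreal (\<Prod>i\<in>UNIV. std_normal_density (z $ i)))"

(* The law N(0, S) is that of A Z, where Z has independent standard normal entries and
   A A^T = S; it does not depend on the choice of A. If S is singular then so is A, and the
   law has no density. *)
definition is_centered_normal :: "(real ^ 'n) measure \<Rightarrow> real ^ 'n ^ 'n \<Rightarrow> bool" where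
  "is_centered_normal P S \<longleftrightarrow>
    (\<exists>A :: real ^ 'n ^ 'n. A ** transpose A = S \<and> P = distr std_gaussian borel (\<lambda>z. A *v z))"

end

theory Submission
  imports Defs
begin

text \<open>
  Up to an additive error of order \<open>1 / \<beta>\<close>, the function \<open>max (max\<^sub>i \<bar>x\<^sub>i\<bar>) t\<close> is
  \<open>G(\<beta> x) / \<beta>\<close> with \<open>G x = ln (c + (\<Sum>i. cosh x\<^sub>i))\<close> and \<open>c = exp (\<beta> t)\<close>. With
  \<open>p\<^sub>i\<close> and \<open>q\<^sub>i\<close> the quotients of \<open>cosh x\<^sub>i\<close> and \<open>sinh x\<^sub>i\<close> by \<open>c + (\<Sum>j. cosh x\<^sub>j)\<close>, the Hessian of
  \<open>G\<close> paired with \<open>D = \<Sigma>\<^sup>Y - \<Sigma>\<^sup>X\<close> is \<open>(\<Sum>i. D\<^sub>i\<^sub>i p\<^sub>i) - (\<Sum>i j. D\<^sub>i\<^sub>j q\<^sub>i q\<^sub>j)\<close>. It is nonnegative because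
  \<open>\<bar>q\<^sub>i\<bar> \<le> p\<^sub>i\<close>, \<open>(\<Sum>i. p\<^sub>i) \<le> 1\<close> and \<open>2 \<bar>D\<^sub>i\<^sub>j\<bar> \<le> D\<^sub>i\<^sub>i + D\<^sub>j\<^sub>j\<close>.

  Hence a Gaussian increment of covariance \<open>\<Sigma>\<^sup>X / n\<close> raises the mean of \<open>G\<close> by at most as much as one of
  covariance \<open>\<Sigma>\<^sup>Y / n\<close>, up to the third-order Taylor error \<open>O(n powr (-3/2))\<close>. Exchanging the \<open>n\<close>
  increments one at a time, as in Lindeberg's proof of the central limit theorem, gives
  \<open>E G(X) \<le> E G(Y) + O(n powr (-1/2))\<close> without Gaussian integration by parts. Letting \<open>\<beta>\<close> tend to infinity
  gives \<open>E (max\<^sub>i \<bar>X\<^sub>i\<bar> - t)\<^sub>+ \<le> E (max\<^sub>i \<bar>Y\<^sub>i\<bar> - t)\<^sub>+\<close> for all \<open>t \<ge> 0\<close>, and for \<open>m > 1\<close> the power \<open>u powr m\<close> is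
  a mixture of the functions \<open>(u - t)\<^sub>+\<close> with the weight \<open>m (m - 1) t powr (m - 2)\<close>.
\<close>

section \<open>The standard Gaussian measure\<close>

lemma Basis_real_vec: "(Basis :: (real ^ 'n) set) = range (\<lambda>i. axis i 1)"
  by (auto simp: Basis_vec_def)

lemma inj_axis: "inj (\<lambda>i::'n::finite. axis i (1::real))"
  by (auto simp: inj_on_def axis_eq_axis)

definition gauss_density :: "real ^ 'n \<Rightarrow> real" where
  "gauss_density z = (\<Prod>i\<in>UNIV. std_normal_density (z $ i))"

lemma gauss_density_nonneg [simp]: "0 \<le> gauss_density z"
  unfolding gauss_density_def by (intro prod_nonneg) auto

lemma borel_measurable_vec_component [measurable]: "(\<lambda>z :: real ^ 'n. z $ i) \<in> borel_measurable borel"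
  by (intro borel_measurable_continuous_onI continuous_intros)

lemma borel_measurable_gauss_density [measurable]: "gauss_density \<in> borel_measurable borel"
  unfolding gauss_density_def[abs_def] by measurable

lemma sets_std_gaussian [simp, measurable_cong]: "sets std_gaussian = sets borel"
  by (simp add: std_gaussian_def)

lemma space_std_gaussian [simp]: "space std_gaussian = UNIV"
  by (simp add: std_gaussian_def)

lemma nn_integral_std_gaussian:
  fixes f :: "real ^ 'n \<Rightarrow> ennreal"
  assumes [measurable]: "f \<in> borel_measurable borel"
  shows "(\<integral>\<^sup>+z. f z \<partial>std_gaussian) = (\<integral>\<^sup>+z. ennreal (gauss_density z) * f z \<partial>lborel)"
  unfolding std_gaussian_def gauss_density_def[symmetric] by (subst nn_integral_density) auto

text \<open>Independence of the coordinates: density and integrand are both products, so Tonelli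
  splits the Lebesgue integral over the basis vectors \<open>axis i 1\<close>.\<close>

lemma nn_integral_std_gaussian_prod:
  fixes f :: "'n::finite \<Rightarrow> real \<Rightarrow> ennreal"
  assumes [measurable]: "\<And>i. f i \<in> borel_measurable borel"
  shows "(\<integral>\<^sup>+z. (\<Prod>i\<in>UNIV. f i (z $ i)) \<partial>(std_gaussian :: (real ^ 'n) measure))
       = (\<Prod>i\<in>UNIV. \<integral>\<^sup>+x. ennreal (std_normal_density x) * f i x \<partial>lborel)"
proof -
  let ?i = "the_inv (\<lambda>i::'n. axis i (1::real))"
  have [simp]: "?i (axis i 1) = i" for i
    by (rule the_inv_f_f[OF inj_axis])
  have "(\<integral>\<^sup>+z. (\<Prod>i\<in>UNIV. f i (z $ i)) \<partial>(std_gaussian :: (real ^ 'n) measure))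
      = (\<integral>\<^sup>+z. (\<Prod>b\<in>Basis. ennreal (std_normal_density (z \<bullet> b)) * f (?i b) (z \<bullet> b)) \<partial>(lborel :: (real ^ 'n) measure))"
    by (subst nn_integral_std_gaussian)
      (auto simp: gauss_density_def Basis_real_vec prod.reindex[OF inj_axis] inner_axis prod_ennreal[symmetric]
        prod.distrib)
  also have "\<dots> = (\<Prod>b\<in>(Basis :: (real ^ 'n) set). \<integral>\<^sup>+x. ennreal (std_normal_density x) * f (?i b) x \<partial>lborel)"
    by (rule nn_integral_lborel_prod[where f="\<lambda>b x. ennreal (std_normal_density x) * f (?i b) x"]) auto
  finally show ?thesis
    by (simp add: Basis_real_vec prod.reindex[OF inj_axis])
qed

section \<open>Total mass and moments of the coordinates\<close>

lemma nn_integral_std_normal_density: "(\<integral>\<^sup>+x. ennreal (std_normal_density x) \<partial>lborel) = 1"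
  using prob_space.emeasure_space_1[OF prob_space_normal_density[of 1 0]]
  by (simp add: emeasure_density)

lemma prob_space_std_gaussian: "prob_space (std_gaussian :: (real ^ 'n) measure)"
proof (rule prob_spaceI)
  show "emeasure (std_gaussian :: (real ^ 'n) measure) (space std_gaussian) = 1"
    using nn_integral_std_gaussian_prod[of "\<lambda>(i::'n) x. 1"]
    by (simp add: nn_integral_std_normal_density)
qed

lemma nn_integral_std_gaussian_coord:
  assumes [measurable]: "f \<in> borel_measurable borel"
  shows "(\<integral>\<^sup>+z. f (z $ i) \<partial>(std_gaussian :: (real ^ 'n) measure))
       = (\<integral>\<^sup>+x. ennreal (std_normal_density x) * f x \<partial>lborel)"
proof -
  have "(\<Prod>j\<in>UNIV. (if j = i then f else (\<lambda>_. 1)) (z $ j)) = f (z $ i)" for z :: "real ^ 'n"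
    by (subst prod.remove[of _ i]) (auto intro!: prod.neutral)
  moreover have "(\<Prod>j\<in>UNIV. \<integral>\<^sup>+x. ennreal (std_normal_density x) * (if j = i then f else (\<lambda>_. 1)) x \<partial>lborel)
     = (\<integral>\<^sup>+x. ennreal (std_normal_density x) * f x \<partial>lborel)"
    by (subst prod.remove[of _ i])
      (auto intro!: prod.neutral simp: nn_integral_std_normal_density)
  ultimately show ?thesis
    using nn_integral_std_gaussian_prod[of "\<lambda>j. if j = i then f else (\<lambda>_. 1)"] by simp
qed

lemma integrable_std_gaussian_coord_power:
  "integrable (std_gaussian :: (real ^ 'n) measure) (\<lambda>z. \<bar>z $ i\<bar> ^ p)"
proof (rule integrableI_nonneg)
  have "(\<integral>\<^sup>+z. ennreal (\<bar>z $ i\<bar> ^ p) \<partial>(std_gaussian :: (real ^ 'n) measure))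
     = (\<integral>\<^sup>+x. ennreal (std_normal_density x * \<bar>x\<bar> ^ p) \<partial>lborel)"
    by (subst nn_integral_std_gaussian_coord) (auto simp: ennreal_mult)
  also have "\<dots> = ennreal (\<integral>x. std_normal_density x * \<bar>x\<bar> ^ p \<partial>lborel)"
    by (intro nn_integral_eq_integral integrable_std_normal_moment_abs) auto
  finally show "(\<integral>\<^sup>+z. ennreal (\<bar>z $ i\<bar> ^ p) \<partial>(std_gaussian :: (real ^ 'n) measure)) < \<infinity>"
    by simp
qed auto

lemma integral_std_gaussian_coord_square:
  "(\<integral>z. (z $ i)\<^sup>2 \<partial>(std_gaussian :: (real ^ 'n) measure)) = 1"
proof -
  have "(\<integral>\<^sup>+z. ennreal ((z $ i)\<^sup>2) \<partial>(std_gaussian :: (real ^ 'n) measure))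
     = (\<integral>\<^sup>+x. ennreal (std_normal_density x * x\<^sup>2) \<partial>lborel)"
    by (subst nn_integral_std_gaussian_coord) (auto simp: ennreal_mult)
  also have "\<dots> = ennreal (\<integral>x. std_normal_density x * x ^ 2 \<partial>lborel)"
    by (intro nn_integral_eq_integral integrable_std_normal_moment) auto
  also have "\<dots> = 1"
    using integral_std_normal_moment_even[of 1] by simp
  finally show ?thesis
    by (subst integral_eq_nn_integral) auto
qed

text \<open>Flipping the sign of one coordinate preserves the measure; this replaces independence in
  the computation of the mixed second moments.\<close>

lemma borel_measurable_flip:
  "(\<lambda>z :: real ^ 'n. \<chi> j. if j = i then - z $ j else z $ j) \<in> borel_measurable borel"
proof (intro borel_measurable_continuous_onI continuous_on_vec_lambda)
  show "continuous_on UNIV (\<lambda>z :: real ^ 'n. if j = i then - z $ j else z $ j)" for j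
    by (cases "j = i") (auto intro!: continuous_intros)
qed

lemma distr_std_gaussian_flip:
  fixes i :: "'n::finite"
  defines "flip \<equiv> \<lambda>z :: real ^ 'n. \<chi> j. if j = i then - z $ j else z $ j"
  shows "distr std_gaussian borel flip = std_gaussian"
proof -
  \<comment> \<open>In this diagonal form the flip is an affine map to which the change of variables
    for \<open>lborel\<close> applies; the factors are 1 and -1, so the Jacobian has absolute value
    1.\<close>
  have flip_eq: "flip = (\<lambda>z. 0 + (\<Sum>b\<in>Basis. ((if b = axis i 1 then -1 else 1) * (z \<bullet> b)) *\<^sub>R b))"
  proof (intro ext vec_eq_iff[THEN iffD2] allI)
    fix z :: "real ^ 'n" and j
    have ax: "axis k (1::real) $ j = (if k = j then 1 else 0)" for k :: 'n
      by (simp add: axis_def)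
    have "(0 + (\<Sum>b\<in>Basis. ((if b = axis i 1 then -1 else 1) * (z \<bullet> b)) *\<^sub>R b)) $ j
        = (\<Sum>k\<in>UNIV. (if k = i then - (z $ k) else z $ k) * (if k = j then 1 else 0))"
      unfolding Basis_real_vec
      by (subst sum.reindex[OF inj_axis])
        (auto simp: axis_eq_axis inner_axis ax intro!: sum.cong)
    also have "\<dots> = flip z $ j"
      unfolding flip_def by (simp add: sum.remove[of UNIV j])
    finally show "flip z $ j
      = (0 + (\<Sum>b\<in>Basis. ((if b = axis i 1 then -1 else 1) * (z \<bullet> b)) *\<^sub>R b)) $ j" ..
  qed
  have [measurable]: "flip \<in> borel_measurable borel"
    unfolding flip_def by (rule borel_measurable_flip)
  have lb: "lborel = distr (lborel :: (real ^ 'n) measure) borel flip"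
    using lborel_affine_euclidean[where t="0 :: real ^ 'n" and c="\<lambda>b. if b = axis i 1 then -1 else 1"]
    by (simp add: flip_eq if_distrib[of abs] density_1 cong: if_cong)
  have [simp]: "gauss_density (flip z) = gauss_density z" for z
    unfolding gauss_density_def by (rule prod.cong) (auto simp: flip_def normal_density_def)
  show ?thesis
  proof (rule measure_eqI)
    fix S assume "S \<in> sets (distr std_gaussian borel flip)"
    then have [measurable]: "S \<in> sets borel" by simp
    have "emeasure (distr std_gaussian borel flip) S
        = (\<integral>\<^sup>+z. indicator S (flip z) \<partial>std_gaussian)"
      by (subst nn_integral_indicator[symmetric], simp, subst nn_integral_distr) auto
    also have "\<dots> = (\<integral>\<^sup>+z. ennreal (gauss_density (flip z)) * indicator S (flip z) \<partial>lborel)"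
      by (subst nn_integral_std_gaussian) auto
    also have "\<dots> = (\<integral>\<^sup>+z. ennreal (gauss_density z) * indicator S z \<partial>(distr lborel borel flip))"
      by (subst nn_integral_distr) auto
    also have "\<dots> = (\<integral>\<^sup>+z. indicator S z \<partial>std_gaussian)"
      unfolding lb[symmetric] by (subst nn_integral_std_gaussian) auto
    finally show "emeasure (distr std_gaussian borel flip) S = emeasure std_gaussian S"
      by simp
  qed simp
qed

text \<open>Invariance under the flip makes the integral equal to its own negative. The change of
  variables also covers non-integrable \<open>f\<close>, whose integral is 0 by convention.\<close>

lemma integral_std_gaussian_flip:
  fixes f :: "real ^ 'n \<Rightarrow> real"
  assumes [measurable]: "f \<in> borel_measurable borel"
    and neg: "\<And>z. f (\<chi> j. if j = i then - z $ j else z $ j) = - f z"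
  shows "(\<integral>z. f z \<partial>std_gaussian) = 0"
proof -
  have m: "(\<lambda>z :: real ^ 'n. \<chi> j. if j = i then - z $ j else z $ j) \<in> borel_measurable std_gaussian"
    by (subst measurable_cong_sets[OF sets_std_gaussian refl]) (rule borel_measurable_flip)
  have "(\<integral>z. f z \<partial>std_gaussian)
      = (\<integral>z. f z \<partial>(distr std_gaussian borel (\<lambda>z. \<chi> j. if j = i then - z $ j else z $ j)))"
    by (simp add: distr_std_gaussian_flip)
  also have "\<dots> = - (\<integral>z. f z \<partial>std_gaussian)"
    by (subst integral_distr[OF m]) (auto simp: neg)
  finally show ?thesis by simp
qed

lemma integral_std_gaussian_coord: "(\<integral>z. z $ i \<partial>std_gaussian) = 0"
  by (rule integral_std_gaussian_flip[where i=i]) auto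

lemma integral_std_gaussian_coord_mult:
  "(\<integral>z. z $ i * z $ j \<partial>std_gaussian) = (if i = j then 1 else 0)"
proof (cases "i = j")
  case True
  then show ?thesis
    using integral_std_gaussian_coord_square[of j] by (simp add: power2_eq_square)
next
  case False
  then show ?thesis
    by (simp add: integral_std_gaussian_flip[where i=i])
qed

lemma integrable_std_gaussian_norm_power:
  "integrable (std_gaussian :: (real ^ 'n) measure) (\<lambda>z. norm z ^ p)"
proof (rule Bochner_Integration.integrable_bound)
  let ?n = "real CARD('n)"
  show "integrable (std_gaussian :: (real ^ 'n) measure) (\<lambda>z. ?n ^ p * (\<Sum>i\<in>UNIV. \<bar>z $ i\<bar> ^ p))"
    by (intro integrable_mult_right Bochner_Integration.integrable_sum
        integrable_std_gaussian_coord_power)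
  show "AE z::real^'n in std_gaussian. norm (norm z ^ p) \<le> norm (?n ^ p * (\<Sum>i\<in>UNIV. \<bar>z $ i\<bar> ^ p))"
  proof (rule AE_I2)
    fix z :: "real ^ 'n"
    \<comment> \<open>\<open>k\<close> is a coordinate of largest modulus, so the norm is at most
      \<open>CARD('n)\<close> times a single coordinate, whose power is one term of the sum.\<close>
    obtain k where k: "\<And>i. \<bar>z $ i\<bar> \<le> \<bar>z $ k\<bar>"
    proof -
      have "Max (range (\<lambda>i. \<bar>z $ i\<bar>)) \<in> range (\<lambda>i. \<bar>z $ i\<bar>)"
        by (rule Max_in) auto
      then obtain k where "Max (range (\<lambda>i. \<bar>z $ i\<bar>)) = \<bar>z $ k\<bar>" by blast
      then have "\<bar>z $ i\<bar> \<le> \<bar>z $ k\<bar>" for i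
        using Max_ge[of "range (\<lambda>i. \<bar>z $ i\<bar>)" "\<bar>z $ i\<bar>"] by auto
      then show ?thesis by (rule that)
    qed
    have "norm z \<le> (\<Sum>i\<in>UNIV. \<bar>z $ i\<bar>)"
      by (rule norm_le_l1_cart)
    also have "\<dots> \<le> ?n * \<bar>z $ k\<bar>"
      using sum_bounded_above[of UNIV "\<lambda>i. \<bar>z $ i\<bar>" "\<bar>z $ k\<bar>"] k by simp
    finally have "norm z ^ p \<le> ?n ^ p * \<bar>z $ k\<bar> ^ p"
      by (metis norm_ge_zero power_mono power_mult_distrib)
    also have "\<dots> \<le> ?n ^ p * (\<Sum>i\<in>UNIV. \<bar>z $ i\<bar> ^ p)"
      by (intro mult_left_mono member_le_sum) auto
    finally show "norm (norm z ^ p) \<le> norm (?n ^ p * (\<Sum>i\<in>UNIV. \<bar>z $ i\<bar> ^ p))"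
      by (simp add: sum_nonneg)
  qed
qed auto

section \<open>The Gaussian averaging operators\<close>

text \<open>Averaging over an increment of law N(0, A A^T). Iterating the operator adds independent
  increments; values in \<open>ennreal\<close> make Tonelli available for every measurable
  \<open>f\<close>.\<close>

definition gauss_op :: "real ^ 'n ^ 'n \<Rightarrow> (real ^ 'n \<Rightarrow> ennreal) \<Rightarrow> real ^ 'n \<Rightarrow> ennreal" where
  "gauss_op A f x = (\<integral>\<^sup>+z. f (x + A *v z) \<partial>std_gaussian)"

lemma borel_measurable_matrix_vector_mult [measurable]:
  "(\<lambda>z. A *v z) \<in> borel_measurable (borel :: (real ^ 'n) measure)"
  by (intro borel_measurable_continuous_onI continuous_intros)

interpretation std_gaussian: prob_space "std_gaussian :: (real ^ 'n) measure"
  by (rule prob_space_std_gaussian)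

interpretation std_gaussian_pair: pair_sigma_finite
  "std_gaussian :: (real ^ 'n) measure" "std_gaussian :: (real ^ 'm) measure" ..

lemma borel_measurable_gauss_op [measurable]:
  assumes [measurable]: "f \<in> borel_measurable borel"
  shows "gauss_op A f \<in> borel_measurable borel"
proof -
  have "(\<lambda>x. \<integral>\<^sup>+z. f (x + A *v z) \<partial>std_gaussian) \<in> borel_measurable borel"
    by measurable
  then show ?thesis
    by (simp add: gauss_op_def[abs_def])
qed

lemma gauss_op_mono: "(\<And>x. f x \<le> g x) \<Longrightarrow> gauss_op A f x \<le> gauss_op A g x"
  unfolding gauss_op_def by (intro nn_integral_mono) auto

lemma gauss_op_add_const:
  assumes [measurable]: "f \<in> borel_measurable borel"
  shows "gauss_op A (\<lambda>x. f x + c) x = gauss_op A f x + c"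
  unfolding gauss_op_def
  by (subst nn_integral_add) (auto simp: std_gaussian.emeasure_space_1[simplified])

text \<open>Tonelli: the order in which two independent increments are added does not
  matter.\<close>

lemma gauss_op_commute:
  assumes [measurable]: "f \<in> borel_measurable borel"
  shows "gauss_op A (gauss_op B f) = gauss_op B (gauss_op A f)"
proof
  fix x
  have "gauss_op A (gauss_op B f) x
      = (\<integral>\<^sup>+z. \<integral>\<^sup>+w. f (x + A *v z + B *v w) \<partial>std_gaussian \<partial>std_gaussian)"
    by (simp add: gauss_op_def)
  also have "\<dots> = (\<integral>\<^sup>+w. \<integral>\<^sup>+z. f (x + A *v z + B *v w) \<partial>std_gaussian \<partial>std_gaussian)"
    by (rule std_gaussian_pair.Fubini'[symmetric]) measurable
  also have "\<dots> = gauss_op B (gauss_op A f) x"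
    by (simp add: gauss_op_def algebra_simps)
  finally show "gauss_op A (gauss_op B f) x = gauss_op B (gauss_op A f) x" .
qed

section \<open>Rotation invariance and the semigroup law\<close>

lemma nn_integral_lborel_affine:
  fixes f :: "'a::euclidean_space \<Rightarrow> ennreal"
  assumes [measurable]: "f \<in> borel_measurable borel" and "c \<noteq> 0"
  shows "(\<integral>\<^sup>+x. f x \<partial>lborel) = ennreal (\<bar>c\<bar> ^ DIM('a)) * (\<integral>\<^sup>+x. f (t + c *\<^sub>R x) \<partial>lborel)"
  by (subst lborel_affine[OF \<open>c \<noteq> 0\<close>, of t])
    (simp add: nn_integral_density nn_integral_distr nn_integral_cmult)

text \<open>Both sides have the exponent \<open>- (x^2 + y^2 - 2 b x y) / (2 a^2)\<close>, symmetric
  in \<open>x\<close> and \<open>y\<close>: up to a constant factor this is the bivariate normal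
  density with correlation \<open>b\<close>.\<close>

lemma std_normal_density_rotate:
  assumes ab: "a\<^sup>2 + b\<^sup>2 = (1::real)" and "a \<noteq> 0"
  shows "std_normal_density y * std_normal_density ((x - b * y) / a)
       = std_normal_density x * std_normal_density ((y - b * x) / a)"
proof -
  have "a\<^sup>2 * (y\<^sup>2 + ((x - b * y) / a)\<^sup>2) = a\<^sup>2 * (x\<^sup>2 + ((y - b * x) / a)\<^sup>2)"
  proof -
    have "a\<^sup>2 * (y\<^sup>2 + ((x - b * y) / a)\<^sup>2) = a\<^sup>2 * y\<^sup>2 + (x - b * y)\<^sup>2"
      using \<open>a \<noteq> 0\<close> by (simp add: field_simps)
    also have "\<dots> = (a\<^sup>2 + b\<^sup>2) * y\<^sup>2 + x\<^sup>2 - 2 * b * x * y"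
      by (simp add: power2_eq_square algebra_simps)
    also have "\<dots> = (a\<^sup>2 + b\<^sup>2) * x\<^sup>2 + y\<^sup>2 - 2 * b * x * y"
      by (simp add: ab)
    also have "\<dots> = a\<^sup>2 * x\<^sup>2 + (y - b * x)\<^sup>2"
      by (simp add: power2_eq_square algebra_simps)
    also have "\<dots> = a\<^sup>2 * (x\<^sup>2 + ((y - b * x) / a)\<^sup>2)"
      using \<open>a \<noteq> 0\<close> by (simp add: field_simps)
    finally show ?thesis .
  qed
  then have "y\<^sup>2 + ((x - b * y) / a)\<^sup>2 = x\<^sup>2 + ((y - b * x) / a)\<^sup>2"
    using \<open>a \<noteq> 0\<close> by simp
  then have "exp (- y\<^sup>2 / 2) * exp (- ((x - b * y) / a)\<^sup>2 / 2)
      = exp (- x\<^sup>2 / 2) * exp (- ((y - b * x) / a)\<^sup>2 / 2)"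
    unfolding exp_add[symmetric] by (intro arg_cong[where f=exp]) linarith
  then show ?thesis
    by (simp add: std_normal_density_def)
qed

lemma gauss_density_rotate:
  fixes x y :: "real ^ 'n"
  assumes "a\<^sup>2 + b\<^sup>2 = (1::real)" "a \<noteq> 0"
  shows "gauss_density y * gauss_density ((1 / a) *\<^sub>R (x - b *\<^sub>R y))
       = gauss_density x * gauss_density ((1 / a) *\<^sub>R (y - b *\<^sub>R x))"
  using std_normal_density_rotate[OF assms]
  by (simp add: gauss_density_def prod.distrib[symmetric])

lemma nn_integral_gauss_density: "(\<integral>\<^sup>+z. ennreal (gauss_density z) \<partial>(lborel :: (real ^ 'n) measure)) = 1"
  using nn_integral_std_gaussian[of "\<lambda>_::real^'n. 1"] std_gaussian.emeasure_space_1[where 'n='n]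
  by simp

text \<open>In the variables \<open>w\<close> and \<open>x = a z + b w\<close> the joint density is
  symmetric. Conditioning on \<open>x\<close> instead of \<open>w\<close> lets \<open>w\<close>
  integrate out, so \<open>a Z + b W\<close> is again standard Gaussian.\<close>

lemma nn_integral_std_gaussian_rotate:
  fixes g :: "real ^ 'n \<Rightarrow> ennreal"
  assumes [measurable]: "g \<in> borel_measurable borel" and ab: "a\<^sup>2 + b\<^sup>2 = (1::real)" "a \<noteq> 0"
  shows "(\<integral>\<^sup>+w. \<integral>\<^sup>+z. g (a *\<^sub>R z + b *\<^sub>R w) \<partial>std_gaussian \<partial>std_gaussian) = (\<integral>\<^sup>+z. g z \<partial>std_gaussian)"
proof -
  define d where "d = ennreal (\<bar>1 / a\<bar> ^ DIM(real ^ 'n))"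
  have [measurable]: "(\<lambda>z. ennreal (gauss_density (z::real^'n))) \<in> borel_measurable borel"
    by measurable
  \<comment> \<open>Substitution \<open>x = a z + b w\<close> for fixed \<open>w\<close>;
    \<open>d\<close> is the Jacobian factor.\<close>
  have inner: "(\<integral>\<^sup>+z. g (a *\<^sub>R z + b *\<^sub>R w) \<partial>std_gaussian)
      = d * (\<integral>\<^sup>+x. ennreal (gauss_density ((1 / a) *\<^sub>R (x - b *\<^sub>R w))) * g x \<partial>lborel)" for w
  proof -
    have "(\<integral>\<^sup>+z. g (a *\<^sub>R z + b *\<^sub>R w) \<partial>std_gaussian)
      = (\<integral>\<^sup>+z. ennreal (gauss_density z) * g (a *\<^sub>R z + b *\<^sub>R w) \<partial>lborel)"
      by (rule nn_integral_std_gaussian) measurable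
    also have "\<dots> = d * (\<integral>\<^sup>+x. ennreal (gauss_density ((- (b / a)) *\<^sub>R w + (1 / a) *\<^sub>R x))
         * g (a *\<^sub>R ((- (b / a)) *\<^sub>R w + (1 / a) *\<^sub>R x) + b *\<^sub>R w) \<partial>lborel)"
      unfolding d_def using ab by (intro nn_integral_lborel_affine) auto
    also have "(\<lambda>x. (- (b / a)) *\<^sub>R w + (1 / a) *\<^sub>R x) = (\<lambda>x. (1 / a) *\<^sub>R (x - b *\<^sub>R w))"
      by (auto simp: algebra_simps)
    finally show ?thesis
      using ab by (simp add: algebra_simps)
  qed
  have "(\<integral>\<^sup>+w. \<integral>\<^sup>+z. g (a *\<^sub>R z + b *\<^sub>R w) \<partial>std_gaussian \<partial>std_gaussian)
      = (\<integral>\<^sup>+w. ennreal (gauss_density w)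
          * (d * (\<integral>\<^sup>+x. ennreal (gauss_density ((1 / a) *\<^sub>R (x - b *\<^sub>R w))) * g x \<partial>lborel)) \<partial>lborel)"
    unfolding inner by (rule nn_integral_std_gaussian) measurable
  also have "\<dots> = (\<integral>\<^sup>+w. \<integral>\<^sup>+x. d * (ennreal (gauss_density w)
          * ennreal (gauss_density ((1 / a) *\<^sub>R (x - b *\<^sub>R w)))) * g x \<partial>lborel \<partial>lborel)"
    by (simp add: nn_integral_cmult[symmetric] ac_simps)
  also have "\<dots> = (\<integral>\<^sup>+w. \<integral>\<^sup>+x. d * (ennreal (gauss_density x)
          * ennreal (gauss_density ((1 / a) *\<^sub>R (w - b *\<^sub>R x)))) * g x \<partial>lborel \<partial>lborel)"
  proof -
    have "ennreal (gauss_density w) * ennreal (gauss_density ((1 / a) *\<^sub>R (x - b *\<^sub>R w)))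
        = ennreal (gauss_density x) * ennreal (gauss_density ((1 / a) *\<^sub>R (w - b *\<^sub>R x)))"
      for w x :: "real ^ 'n"
      using gauss_density_rotate[OF ab, of w x] by (simp add: ennreal_mult[symmetric])
    then show ?thesis
      by (intro nn_integral_cong arg_cong2[where f="(*)", OF arg_cong2[where f="(*)", OF refl] refl])
  qed
  also have "\<dots> = (\<integral>\<^sup>+x. \<integral>\<^sup>+w. d * (ennreal (gauss_density x)
          * ennreal (gauss_density ((1 / a) *\<^sub>R (w - b *\<^sub>R x)))) * g x \<partial>lborel \<partial>lborel)"
    by (rule lborel_pair.Fubini'[symmetric]) measurable
  also have "\<dots> = (\<integral>\<^sup>+x. ennreal (gauss_density x) * g x
          * (d * (\<integral>\<^sup>+w. ennreal (gauss_density ((1 / a) *\<^sub>R (w - b *\<^sub>R x))) \<partial>lborel)) \<partial>lborel)"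
    by (simp add: nn_integral_cmult[symmetric] ac_simps)
  also have "\<dots> = (\<integral>\<^sup>+x. ennreal (gauss_density x) * g x \<partial>lborel)"
  proof -
    \<comment> \<open>Given \<open>x\<close>, the variable \<open>w\<close> has a shifted and scaled
      Gaussian density of total mass 1.\<close>
    have "d * (\<integral>\<^sup>+w. ennreal (gauss_density ((1 / a) *\<^sub>R (w - b *\<^sub>R x))) \<partial>lborel) = 1" for x :: "real ^ 'n"
    proof -
      have "1 = d * (\<integral>\<^sup>+w. ennreal (gauss_density ((- (b / a)) *\<^sub>R x + (1 / a) *\<^sub>R w)) \<partial>lborel)"
        unfolding d_def nn_integral_gauss_density[symmetric, where 'n='n]
        using ab by (intro nn_integral_lborel_affine) auto
      also have "(\<lambda>w. (- (b / a)) *\<^sub>R x + (1 / a) *\<^sub>R w) = (\<lambda>w. (1 / a) *\<^sub>R (w - b *\<^sub>R x))"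
        by (auto simp: algebra_simps)
      finally show ?thesis by simp
    qed
    then show ?thesis by simp
  qed
  also have "\<dots> = (\<integral>\<^sup>+z. g z \<partial>std_gaussian)"
    by (rule nn_integral_std_gaussian[symmetric]) measurable
  finally show ?thesis .
qed

text \<open>Rotation invariance with coefficients \<open>a / c\<close> and \<open>b / c\<close>
  merges the two independent increments into one: variances add.\<close>

lemma gauss_op_semigroup:
  assumes [measurable]: "f \<in> borel_measurable borel"
    and abc: "a\<^sup>2 + b\<^sup>2 = c\<^sup>2" "a \<noteq> (0::real)"
  shows "gauss_op (b *\<^sub>R A) (gauss_op (a *\<^sub>R A) f) = gauss_op (c *\<^sub>R A) f"
proof -
  have c: "c \<noteq> 0"
    using abc by (metis add_nonneg_eq_0_iff zero_le_power2 power_zero_numeral power_eq_0_iff)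
  have "(a / c)\<^sup>2 + (b / c)\<^sup>2 = 1"
    using abc c by (simp add: power_divide add_divide_distrib[symmetric])
  then have rot: "(\<integral>\<^sup>+w. \<integral>\<^sup>+z. f (x + (c *\<^sub>R A) *v ((a / c) *\<^sub>R z + (b / c) *\<^sub>R w)) \<partial>std_gaussian \<partial>std_gaussian)
      = (\<integral>\<^sup>+z. f (x + (c *\<^sub>R A) *v z) \<partial>std_gaussian)" for x
    using abc c by (intro nn_integral_std_gaussian_rotate) auto
  have "(c *\<^sub>R A) *v ((a / c) *\<^sub>R z + (b / c) *\<^sub>R w) = (b *\<^sub>R A) *v w + (a *\<^sub>R A) *v z" for z w
    using c by (simp add: matrix_vector_right_distrib matrix_vector_mult_scaleR scaleR_matrix_vector_assoc[symmetric] add.commute)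
  with rot show ?thesis
    by (simp add: gauss_op_def[abs_def] add.assoc)
qed

lemma gauss_op_power:
  assumes [measurable]: "f \<in> borel_measurable borel"
  shows "(gauss_op A ^^ n) f = gauss_op (sqrt n *\<^sub>R A) f"
proof (induction n)
  case 0
  then show ?case
    by (simp add: gauss_op_def[abs_def] std_gaussian.emeasure_space_1[simplified])
next
  case (Suc n)
  have "(gauss_op A ^^ Suc n) f = gauss_op (1 *\<^sub>R A) (gauss_op (sqrt n *\<^sub>R A) f)"
    using Suc.IH by simp
  \<comment> \<open>The operators are swapped because the semigroup law asks for a nonzero scale on
    the inner one, and \<open>sqrt n\<close> vanishes for \<open>n = 0\<close>.\<close>
  also have "\<dots> = gauss_op (sqrt n *\<^sub>R A) (gauss_op (1 *\<^sub>R A) f)"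
    by (rule gauss_op_commute) simp
  also have "\<dots> = gauss_op (sqrt (Suc n) *\<^sub>R A) f"
    by (rule gauss_op_semigroup) auto
  finally show ?case .
qed

section \<open>Exchanging the increments one at a time\<close>

lemma borel_measurable_gauss_op_power [measurable]:
  assumes [measurable]: "f \<in> borel_measurable borel"
  shows "(gauss_op A ^^ n) f \<in> borel_measurable borel"
  by (induction n) auto

lemma gauss_op_power_commute:
  assumes [measurable]: "f \<in> borel_measurable borel"
  shows "gauss_op A ((gauss_op B ^^ n) f) = (gauss_op B ^^ n) (gauss_op A f)"
  by (simp add: gauss_op_power gauss_op_commute)

text \<open>Lindeberg exchange: by commutation the increment to be replaced acts directly on
  \<open>f\<close>, where the hypothesis applies, and the constant \<open>e\<close> passes unchanged
  through the remaining averages because they have total mass 1.\<close>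

lemma gauss_op_power_le:
  assumes [measurable]: "f \<in> borel_measurable borel"
    and le: "\<And>x. gauss_op A f x \<le> gauss_op B f x + e"
  shows "(gauss_op A ^^ n) f x \<le> (gauss_op B ^^ n) f x + of_nat n * e"
proof (induction n arbitrary: x)
  case 0
  then show ?case by simp
next
  case (Suc n)
  have "(gauss_op A ^^ Suc n) f x \<le> gauss_op A (\<lambda>x. (gauss_op B ^^ n) f x + of_nat n * e) x"
    by (simp add: gauss_op_mono Suc.IH)
  also have "\<dots> = (gauss_op B ^^ n) (gauss_op A f) x + of_nat n * e"
    by (simp add: gauss_op_add_const gauss_op_power_commute)
  also have "\<dots> \<le> (gauss_op B ^^ n) (\<lambda>x. gauss_op B f x + e) x + of_nat n * e"
    by (simp add: gauss_op_power gauss_op_mono le add_right_mono)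
  also have "\<dots> = (gauss_op B ^^ n) (gauss_op B f) x + e + of_nat n * e"
    by (simp add: gauss_op_power gauss_op_add_const)
  also have "\<dots> = (gauss_op B ^^ Suc n) f x + of_nat (Suc n) * e"
    by (simp add: gauss_op_power_commute[symmetric] distrib_right add.assoc)
  finally show ?case .
qed

section \<open>Taylor expansion of the smoothed maximum\<close>

text \<open>A log-sum-exp: \<open>cosh\<close> averages the exponentials of \<open>x $ i\<close> and
  \<open>- x $ i\<close> and so smooths the absolute value, while \<open>ln c\<close> competes with
  the coordinates as a threshold.\<close>

definition log_cosh_sum :: "real \<Rightarrow> real ^ 'n \<Rightarrow> real" where
  "log_cosh_sum c x = ln (c + (\<Sum>i\<in>UNIV. cosh (x $ i)))"

text \<open>Divided by \<open>c + hyp_moment cosh 0 v x\<close>, these are the moments of the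
  entries of \<open>v\<close> under the weights \<open>p\<close> and \<open>q\<close> of the
  introduction. Each derivative along \<open>v\<close> raises \<open>k\<close> by one and swaps
  \<open>cosh\<close> and \<open>sinh\<close>; for \<open>k = 0\<close> the value is independent of
  \<open>v\<close>.\<close>

definition hyp_moment :: "(real \<Rightarrow> real) \<Rightarrow> nat \<Rightarrow> real ^ 'n \<Rightarrow> real ^ 'n \<Rightarrow> real" where
  "hyp_moment h k v x = (\<Sum>i\<in>UNIV. (v $ i) ^ k * h (x $ i))"

lemma DERIV_hyp_moment_cosh:
  "((\<lambda>s. hyp_moment cosh k v (x + s *\<^sub>R v)) has_field_derivative
     hyp_moment sinh (Suc k) v (x + s *\<^sub>R v)) (at s)"
  unfolding hyp_moment_def
  by (auto intro!: derivative_eq_intros sum.cong simp: ac_simps)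

lemma DERIV_hyp_moment_sinh:
  "((\<lambda>s. hyp_moment sinh k v (x + s *\<^sub>R v)) has_field_derivative
     hyp_moment cosh (Suc k) v (x + s *\<^sub>R v)) (at s)"
  unfolding hyp_moment_def
  by (auto intro!: derivative_eq_intros sum.cong simp: ac_simps)

lemma hyp_moment_cosh_0_ge_1: "1 \<le> hyp_moment cosh 0 v (x :: real ^ 'n)"
proof -
  have "1 \<le> (\<Sum>i\<in>(UNIV :: 'n set). 1 :: real)"
    by simp
  also have "\<dots> \<le> (\<Sum>i\<in>UNIV. cosh (x $ i))"
    by (intro sum_mono cosh_real_ge_1)
  finally show ?thesis by (simp add: hyp_moment_def)
qed

lemma abs_sinh_le_cosh: "\<bar>sinh x\<bar> \<le> cosh (x::real)"
  using sinh_le_cosh_real[of x] sinh_le_cosh_real[of "-x"] by (auto simp: abs_if)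

text \<open>The normalized weights of \<open>cosh\<close> add up to at most 1 and dominate those of
  \<open>h\<close>, and no entry of \<open>v\<close> exceeds \<open>norm v\<close> in
  modulus.\<close>

lemma abs_hyp_moment_le:
  assumes "c \<ge> 0" and h: "\<And>y. \<bar>h y\<bar> \<le> cosh y"
  shows "\<bar>hyp_moment h k v x / (c + hyp_moment cosh 0 v x)\<bar> \<le> norm v ^ k"
proof -
  have pos: "0 < c + hyp_moment cosh 0 v x"
    using hyp_moment_cosh_0_ge_1[of v x] assms by linarith
  have "\<bar>hyp_moment h k v x\<bar> \<le> (\<Sum>i\<in>UNIV. norm v ^ k * cosh (x $ i))"
    unfolding hyp_moment_def
    by (rule order_trans[OF sum_abs])
      (auto simp: abs_mult power_abs h component_le_norm_cart intro!: sum_mono mult_mono power_mono)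
  also have "\<dots> = norm v ^ k * hyp_moment cosh 0 v x"
    by (simp add: hyp_moment_def sum_distrib_left)
  also have "\<dots> \<le> norm v ^ k * (c + hyp_moment cosh 0 v x)"
    using assms by (intro mult_left_mono) auto
  finally show ?thesis
    using pos by (simp add: divide_le_eq)
qed

text \<open>Maclaurin's formula along the segment from \<open>x\<close> to \<open>x + v\<close>. The
  derivatives of the logarithm are the cumulants \<open>m1\<close>, \<open>m2 - m1^2\<close> and
  \<open>m3 - 3 m1 m2 + 2 m1^3\<close>; the last is at most \<open>6 * norm v ^ 3\<close> in
  modulus, and the 6 cancels against \<open>fact 3\<close>.\<close>

lemma log_cosh_sum_taylor:
  fixes x v :: "real ^ 'n"
  assumes c: "c \<ge> 0"
  defines "S \<equiv> c + hyp_moment cosh 0 v x"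
  shows "\<bar>log_cosh_sum c (x + v) - (log_cosh_sum c x + hyp_moment sinh 1 v x / S
     + (hyp_moment cosh 2 v x / S - (hyp_moment sinh 1 v x / S)\<^sup>2) / 2)\<bar> \<le> norm v ^ 3"
proof -
  define S0 where "S0 s = c + hyp_moment cosh 0 v (x + s *\<^sub>R v)" for s
  define m1 where "m1 s = hyp_moment sinh 1 v (x + s *\<^sub>R v) / S0 s" for s
  define m2 where "m2 s = hyp_moment cosh 2 v (x + s *\<^sub>R v) / S0 s" for s
  define m3 where "m3 s = hyp_moment sinh 3 v (x + s *\<^sub>R v) / S0 s" for s
  have S0: "S0 s \<ge> 1" for s
    unfolding S0_def using hyp_moment_cosh_0_ge_1[of v "x + s *\<^sub>R v"] c by linarith
  have S0': "S0 s > 0" "S0 s \<noteq> 0" for s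
    using S0[of s] by auto
  have dS0: "(S0 has_field_derivative hyp_moment sinh 1 v (x + s *\<^sub>R v)) (at s)" for s
    unfolding S0_def[abs_def] using DERIV_hyp_moment_cosh[of 0 v x s]
    by (auto intro!: derivative_eq_intros)
  have d1: "(m1 has_field_derivative m2 s - (m1 s)\<^sup>2) (at s)" for s
    unfolding m1_def[abs_def] m2_def using DERIV_hyp_moment_sinh[of 1 v x s] S0'[of s]
    by (auto intro!: derivative_eq_intros dS0 simp: numeral_2_eq_2 field_simps power2_eq_square)
  have d2: "(m2 has_field_derivative m3 s - m2 s * m1 s) (at s)" for s
    unfolding m1_def m2_def[abs_def] m3_def using DERIV_hyp_moment_cosh[of 2 v x s] S0'[of s]
    by (auto intro!: derivative_eq_intros dS0 simp: numeral_3_eq_3 numeral_2_eq_2 field_simps power2_eq_square)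
  have d0: "((\<lambda>s. ln (S0 s)) has_field_derivative m1 s) (at s)" for s
    unfolding m1_def using S0'[of s]
    by (auto intro!: derivative_eq_intros dS0 simp: field_simps)
  define D where "D s = m3 s - 3 * (m1 s * m2 s) + 2 * (m1 s) ^ 3" for s
  define diff where "diff k = (if k = 0 then \<lambda>s. ln (S0 s) else if k = 1 then m1
     else if k = 2 then \<lambda>s. m2 s - (m1 s)\<^sup>2 else D)" for k :: nat
  have "\<exists>t. 0 < t \<and> t < 1 \<and> ln (S0 1) = (\<Sum>k<3. (diff k 0 / fact k) * 1 ^ k) + (diff 3 t / fact 3) * 1 ^ 3"
  proof (rule Maclaurin)
    show "\<forall>k t. k < 3 \<and> 0 \<le> t \<and> t \<le> 1 \<longrightarrow> (diff k has_field_derivative diff (Suc k) t) (at t)"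
    proof (intro allI impI)
      fix k :: nat and t :: real assume "k < 3 \<and> 0 \<le> t \<and> t \<le> 1"
      then consider "k = 0" | "k = 1" | "k = 2" by linarith
      then show "(diff k has_field_derivative diff (Suc k) t) (at t)"
      proof cases
        case 3
        have "((\<lambda>s. m2 s - (m1 s)\<^sup>2) has_field_derivative D t) (at t)"
          by (auto intro!: derivative_eq_intros d1 d2
              simp: D_def algebra_simps power2_eq_square power3_eq_cube)
        with 3 show ?thesis by (simp add: diff_def)
      qed (auto simp: diff_def d0 d1)
    qed
  qed (auto simp: diff_def)
  then obtain t where t: "ln (S0 1) = ln (S0 0) + m1 0 + (m2 0 - (m1 0)\<^sup>2) / 2 + D t / 6"
    by (auto simp: diff_def eval_nat_numeral)
  have b1: "\<bar>m1 s\<bar> \<le> norm v" for s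
    using abs_hyp_moment_le[OF c, of sinh 1 v "x + s *\<^sub>R v"]
    by (simp add: m1_def S0_def hyp_moment_def abs_sinh_le_cosh)
  have b2: "\<bar>m2 s\<bar> \<le> norm v ^ 2" for s
    using abs_hyp_moment_le[OF c, of cosh 2 v "x + s *\<^sub>R v"]
    by (simp add: m2_def S0_def hyp_moment_def)
  have b3: "\<bar>m3 s\<bar> \<le> norm v ^ 3" for s
    using abs_hyp_moment_le[OF c, of sinh 3 v "x + s *\<^sub>R v"]
    by (simp add: m3_def S0_def hyp_moment_def abs_sinh_le_cosh)
  have "\<bar>m1 t * m2 t\<bar> \<le> norm v ^ 3"
    using mult_mono[OF b1[of t] b2[of t]] by (simp add: abs_mult power2_eq_square power3_eq_cube)
  moreover have "\<bar>m1 t ^ 3\<bar> \<le> norm v ^ 3"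
    using power_mono[OF b1[of t], of 3] by (simp add: power_abs)
  \<comment> \<open>The three terms of \<open>D t\<close> contribute 1, 3 and 2 times
    \<open>norm v ^ 3\<close>.\<close>
  ultimately have "\<bar>D t\<bar> \<le> 6 * norm v ^ 3"
    using b3[of t] unfolding D_def by linarith
  moreover have "log_cosh_sum c (x + v) = ln (S0 1)" "log_cosh_sum c x = ln (S0 0)" "S0 0 = S"
    by (auto simp: log_cosh_sum_def S0_def hyp_moment_def S_def)
  ultimately show ?thesis
    using t by (simp add: m1_def m2_def)
qed

section \<open>Moments of linear images of the Gaussian\<close>

lemma integrable_std_gaussian_mult:
  fixes f g :: "real ^ 'n \<Rightarrow> real"
  assumes [measurable]: "f \<in> borel_measurable borel" "g \<in> borel_measurable borel"
    and f: "\<And>z. \<bar>f z\<bar> \<le> K * norm z" and g: "\<And>z. \<bar>g z\<bar> \<le> L * norm z"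
  shows "integrable std_gaussian (\<lambda>z. f z * g z)"
proof (rule Bochner_Integration.integrable_bound)
  show "integrable (std_gaussian :: (real ^ 'n) measure) (\<lambda>z. (K * L) * norm z ^ 2)"
    by (intro integrable_mult_right integrable_std_gaussian_norm_power)
  show "AE z in std_gaussian. norm (f z * g z) \<le> norm (K * L * norm z ^ 2)"
  proof (rule AE_I2)
    fix z
    have "norm (f z * g z) \<le> (K * norm z) * (L * norm z)"
      unfolding real_norm_def abs_mult using f[of z] g[of z] by (intro mult_mono) auto
    then show "norm (f z * g z) \<le> norm (K * L * norm z ^ 2)"
      by (simp add: power2_eq_square algebra_simps)
  qed
qed simp

lemma integrable_std_gaussian_coord: "integrable (std_gaussian :: (real ^ 'n) measure) (\<lambda>z. z $ i)"
  using integrable_std_gaussian_coord_power[of i 1] by (simp add: integrable_abs_iff)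

lemma integrable_std_gaussian_coord_mult:
  "integrable (std_gaussian :: (real ^ 'n) measure) (\<lambda>z. z $ i * z $ j)"
  by (rule integrable_std_gaussian_mult[where K=1 and L=1]) (auto simp: component_le_norm_cart)

lemma matrix_vector_mult_nth: "(A *v z) $ i = (\<Sum>j\<in>UNIV. A $ i $ j * z $ j)"
  by (simp add: matrix_vector_mult_def)

lemma has_bochner_integral_std_gaussian_linear:
  fixes A :: "real ^ 'n ^ 'n"
  shows "has_bochner_integral std_gaussian (\<lambda>z. (A *v z) $ i) 0"
  unfolding has_bochner_integral_iff matrix_vector_mult_nth
  by (simp add: integrable_std_gaussian_coord integral_std_gaussian_coord)

text \<open>After expanding both coordinates only the terms with \<open>k = l\<close> survive, since
  the coordinates of \<open>z\<close> are uncorrelated with variance 1.\<close>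

lemma has_bochner_integral_std_gaussian_quadratic:
  fixes A :: "real ^ 'n ^ 'n"
  shows "has_bochner_integral std_gaussian (\<lambda>z. (A *v z) $ i * (A *v z) $ j) ((A ** transpose A) $ i $ j)"
proof -
  have eq: "(A *v z) $ i * (A *v z) $ j
      = (\<Sum>k\<in>UNIV. \<Sum>l\<in>UNIV. (A $ i $ k * A $ j $ l) * (z $ k * z $ l))" for z
    unfolding matrix_vector_mult_nth by (simp add: sum_product ac_simps)
  have "(\<integral>z. (A *v z) $ i * (A *v z) $ j \<partial>std_gaussian)
      = (\<Sum>k\<in>UNIV. \<Sum>l\<in>UNIV. (A $ i $ k * A $ j $ l) * (if k = l then 1 else 0))"
    unfolding eq by (simp add: integrable_std_gaussian_coord_mult integral_std_gaussian_coord_mult)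
  also have "\<dots> = (A ** transpose A) $ i $ j"
    by (simp add: matrix_matrix_mult_def transpose_def if_distrib cong: if_cong)
  finally show ?thesis
    unfolding has_bochner_integral_iff unfolding eq
    by (simp add: integrable_std_gaussian_coord_mult)
qed

lemma integrable_std_gaussian_linear_norm:
  fixes A :: "real ^ 'n ^ 'n"
  shows "integrable std_gaussian (\<lambda>z. norm (A *v z) ^ p)"
proof (rule Bochner_Integration.integrable_bound)
  let ?K = "onorm ((*v) A)"
  show "integrable (std_gaussian :: (real ^ 'n) measure) (\<lambda>z. ?K ^ p * norm z ^ p)"
    by (intro integrable_mult_right integrable_std_gaussian_norm_power)
  show "AE z in std_gaussian. norm (norm (A *v z) ^ p) \<le> norm (?K ^ p * norm z ^ p)"
  proof (rule AE_I2)
    fix z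
    have "norm (A *v z) ^ p \<le> (?K * norm z) ^ p"
      by (intro power_mono onorm matrix_vector_mul_bounded_linear) auto
    then show "norm (norm (A *v z) ^ p) \<le> norm (?K ^ p * norm z ^ p)"
      by (simp add: power_mult_distrib)
  qed
qed simp

section \<open>The Lindeberg replacement\<close>

text \<open>For centered \<open>X\<close> and \<open>Y\<close> with covariances \<open>S\<close> and
  \<open>T\<close>, resolving the absolute value turns this into
  \<open>E (X i + X j)^2 \<le> E (Y i + Y j)^2\<close> and
  \<open>E (X i - X j)^2 \<le> E (Y i - Y j)^2\<close>.\<close>

definition abs_increments_le :: "real ^ 'n ^ 'n \<Rightarrow> real ^ 'n ^ 'n \<Rightarrow> bool" where
  "abs_increments_le S T \<longleftrightarrow>
    (\<forall>i j. 2 * \<bar>S $ i $ j - T $ i $ j\<bar> \<le> T $ i $ i - S $ i $ i + T $ j $ j - S $ j $ j)"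

text \<open>All covariances scale by \<open>d^2\<close>. This serves both the increments of scale
  \<open>1 / sqrt n\<close> and the smoothing parameter \<open>b\<close>.\<close>

lemma abs_increments_le_scaleR:
  fixes A B :: "real ^ 'n ^ 'n"
  assumes D: "abs_increments_le (A ** transpose A) (B ** transpose B)"
  shows "abs_increments_le ((d *\<^sub>R A) ** transpose (d *\<^sub>R A)) ((d *\<^sub>R B) ** transpose (d *\<^sub>R B))"
proof -
  have scale: "((d *\<^sub>R C) ** transpose (d *\<^sub>R C)) $ i $ j = d\<^sup>2 * (C ** transpose C) $ i $ j"
    for C :: "real ^ 'n ^ 'n" and i j
    by (simp add: matrix_matrix_mult_def transpose_def sum_distrib_left power2_eq_square ac_simps)
  show ?thesis
    unfolding abs_increments_le_def scale
  proof (intro allI)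
    fix i j
    let ?S = "A ** transpose A" and ?T = "B ** transpose B"
    have "d\<^sup>2 * (2 * \<bar>?S $ i $ j - ?T $ i $ j\<bar>)
        \<le> d\<^sup>2 * (?T $ i $ i - ?S $ i $ i + ?T $ j $ j - ?S $ j $ j)"
      using D unfolding abs_increments_le_def by (intro mult_left_mono) auto
    moreover have "\<bar>d\<^sup>2 * ?S $ i $ j - d\<^sup>2 * ?T $ i $ j\<bar> = d\<^sup>2 * \<bar>?S $ i $ j - ?T $ i $ j\<bar>"
      by (simp add: right_diff_distrib[symmetric] abs_mult)
    ultimately show "2 * \<bar>d\<^sup>2 * ?S $ i $ j - d\<^sup>2 * ?T $ i $ j\<bar>
        \<le> d\<^sup>2 * ?T $ i $ i - d\<^sup>2 * ?S $ i $ i + d\<^sup>2 * ?T $ j $ j - d\<^sup>2 * ?S $ j $ j"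
      by (simp add: algebra_simps)
  qed
qed

lemma log_cosh_sum_nonneg: "c \<ge> 0 \<Longrightarrow> 0 \<le> log_cosh_sum c (x :: real ^ 'n)"
  using hyp_moment_cosh_0_ge_1[of 0 x] by (simp add: log_cosh_sum_def hyp_moment_def ln_ge_zero)

lemma borel_measurable_log_cosh_sum [measurable]: "log_cosh_sum c \<in> borel_measurable borel"
  unfolding log_cosh_sum_def[abs_def] cosh_field_def by measurable

text \<open>The Taylor polynomial \<open>P\<close> integrates exactly: its linear part has mean 0
  and its quadratic part sees only the covariance \<open>S\<close>. Only the cubic remainder is
  estimated.\<close>

lemma log_cosh_sum_expectation:
  fixes A :: "real ^ 'n ^ 'n" and x :: "real ^ 'n"
  assumes c: "c \<ge> 0"
  defines "p \<equiv> \<lambda>i. cosh (x $ i) / (c + (\<Sum>j\<in>UNIV. cosh (x $ j)))"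
    and "q \<equiv> \<lambda>i. sinh (x $ i) / (c + (\<Sum>j\<in>UNIV. cosh (x $ j)))"
    and "S \<equiv> A ** transpose A"
  shows "integrable std_gaussian (\<lambda>z. log_cosh_sum c (x + A *v z))" (is ?I)
    and "\<bar>(\<integral>z. log_cosh_sum c (x + A *v z) \<partial>std_gaussian) - (log_cosh_sum c x +
        ((\<Sum>i\<in>UNIV. S $ i $ i * p i) - (\<Sum>i\<in>UNIV. \<Sum>j\<in>UNIV. S $ i $ j * (q i * q j))) / 2)\<bar>
      \<le> (\<integral>z. norm (A *v z) ^ 3 \<partial>std_gaussian)" (is ?E)
proof -
  define P where "P z = log_cosh_sum c x + (\<Sum>i\<in>UNIV. (A *v z) $ i * q i)
    + ((\<Sum>i\<in>UNIV. ((A *v z) $ i * (A *v z) $ i) * p i)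
      - (\<Sum>i\<in>UNIV. \<Sum>j\<in>UNIV. ((A *v z) $ i * (A *v z) $ j) * (q i * q j))) / 2" for z
  have P: "has_bochner_integral std_gaussian P (log_cosh_sum c x + (\<Sum>i\<in>UNIV. 0 * q i)
    + ((\<Sum>i\<in>UNIV. S $ i $ i * p i) - (\<Sum>i\<in>UNIV. \<Sum>j\<in>UNIV. S $ i $ j * (q i * q j))) / 2)"
    unfolding P_def[abs_def] S_def
    by (intro has_bochner_integral_add has_bochner_integral_divide_zero has_bochner_integral_diff
        has_bochner_integral_sum has_bochner_integral_mult_left
        has_bochner_integral_std_gaussian_linear has_bochner_integral_std_gaussian_quadratic)
      (auto simp: has_bochner_integral_iff std_gaussian.prob_space[simplified])
  note intP = P[unfolded has_bochner_integral_iff]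
  have taylor: "\<bar>log_cosh_sum c (x + A *v z) - P z\<bar> \<le> norm (A *v z) ^ 3" for z
  proof -
    let ?v = "A *v z" and ?S = "c + (\<Sum>j\<in>UNIV. cosh (x $ j))"
    have S: "c + hyp_moment cosh 0 ?v x = ?S"
      by (simp add: hyp_moment_def)
    have "hyp_moment sinh 1 ?v x / ?S = (\<Sum>i\<in>UNIV. ?v $ i * q i)"
      by (simp add: hyp_moment_def q_def sum_divide_distrib)
    moreover have "hyp_moment cosh 2 ?v x / ?S = (\<Sum>i\<in>UNIV. (?v $ i * ?v $ i) * p i)"
      by (simp add: hyp_moment_def p_def sum_divide_distrib power2_eq_square)
    moreover have "(\<Sum>i\<in>UNIV. ?v $ i * q i)\<^sup>2
        = (\<Sum>i\<in>UNIV. \<Sum>j\<in>UNIV. (?v $ i * ?v $ j) * (q i * q j))"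
      by (simp add: power2_eq_square sum_product ac_simps)
    ultimately show ?thesis
      using log_cosh_sum_taylor[OF c, of x ?v] by (simp add: S P_def)
  qed
  \<comment> \<open>Integrability of the smoothed maximum is inherited: \<open>P\<close> is
    integrable and the difference is dominated by a cubic moment.\<close>
  have int_R: "integrable std_gaussian (\<lambda>z. log_cosh_sum c (x + A *v z) - P z)"
  proof (rule Bochner_Integration.integrable_bound[OF integrable_std_gaussian_linear_norm[of A 3]])
    show "(\<lambda>z. log_cosh_sum c (x + A *v z) - P z) \<in> borel_measurable std_gaussian"
      unfolding P_def[abs_def] by measurable
  qed (use taylor in auto)
  from Bochner_Integration.integrable_add[OF int_R conjunct1[OF intP]]
  show I: ?I by simp
  have "(\<integral>z. log_cosh_sum c (x + A *v z) \<partial>std_gaussian) - (\<integral>z. P z \<partial>std_gaussian)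
      = (\<integral>z. log_cosh_sum c (x + A *v z) - P z \<partial>std_gaussian)"
    by (rule Bochner_Integration.integral_diff[symmetric, OF I conjunct1[OF intP]])
  moreover have "\<bar>\<integral>z. log_cosh_sum c (x + A *v z) - P z \<partial>std_gaussian\<bar>
      \<le> (\<integral>z. norm (A *v z) ^ 3 \<partial>std_gaussian)"
    using int_R taylor
    by (intro order_trans[OF integral_abs_bound] integral_mono integrable_std_gaussian_linear_norm) auto
  ultimately show ?E
    by (simp add: conjunct2[OF intP])
qed

text \<open>With \<open>D = T - S\<close>, each \<open>q i * q j\<close> is bounded by
  \<open>p i * p j\<close> and each \<open>D i j\<close> by the mean of \<open>D i i\<close> and
  \<open>D j j\<close>. The resulting double sum factors into the sum of \<open>D i i * p i\<close>
  and the sum of \<open>p i\<close>, which is at most 1.\<close>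

lemma abs_increments_le_quadratic:
  fixes p q :: "'n::finite \<Rightarrow> real"
  assumes D: "abs_increments_le S T" and q: "\<And>i. \<bar>q i\<bar> \<le> p i" and p: "(\<Sum>i\<in>UNIV. p i) \<le> 1"
  shows "(\<Sum>i\<in>UNIV. S $ i $ i * p i) - (\<Sum>i\<in>UNIV. \<Sum>j\<in>UNIV. S $ i $ j * (q i * q j))
    \<le> (\<Sum>i\<in>UNIV. T $ i $ i * p i) - (\<Sum>i\<in>UNIV. \<Sum>j\<in>UNIV. T $ i $ j * (q i * q j))"
proof -
  let ?D = "\<lambda>i j. T $ i $ j - S $ i $ j"
  have D': "2 * \<bar>?D i j\<bar> \<le> ?D i i + ?D j j" for i j
    using D[unfolded abs_increments_le_def, rule_format, of i j] by (simp add: abs_minus_commute)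
  \<comment> \<open>The case \<open>i = j\<close> of the hypothesis forces a nonnegative diagonal of
    \<open>?D\<close>.\<close>
  have "2 * \<bar>u\<bar> \<le> u + u \<Longrightarrow> 0 \<le> u" for u :: real
    by linarith
  then have Dnn: "0 \<le> ?D i i" for i
    using D'[of i i] by blast
  have pnn: "0 \<le> p i" for i
    using q[of i] abs_ge_zero[of "q i"] by (rule order_trans[rotated])
  have "(\<Sum>i\<in>UNIV. \<Sum>j\<in>UNIV. ?D i j * (q i * q j))
      \<le> (\<Sum>i\<in>UNIV. \<Sum>j\<in>UNIV. ((?D i i + ?D j j) / 2) * (p i * p j))"
  proof (intro sum_mono)
    fix i j
    have "?D i j * (q i * q j) \<le> \<bar>?D i j\<bar> * (\<bar>q i\<bar> * \<bar>q j\<bar>)"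
      by (metis abs_ge_self abs_mult)
    also have "\<dots> \<le> ((?D i i + ?D j j) / 2) * (p i * p j)"
      using D'[of i j] q Dnn pnn by (intro mult_mono) auto
    finally show "?D i j * (q i * q j) \<le> ((?D i i + ?D j j) / 2) * (p i * p j)" .
  qed
  also have "\<dots> = (\<Sum>i\<in>UNIV. \<Sum>j\<in>UNIV. (?D i i * p i) * p j / 2)
      + (\<Sum>i\<in>UNIV. \<Sum>j\<in>UNIV. p i * (?D j j * p j) / 2)"
    unfolding sum.distrib[symmetric] by (intro sum.cong) (auto simp: field_simps)
  also have "\<dots> = (\<Sum>i\<in>UNIV. ?D i i * p i) * (\<Sum>i\<in>UNIV. p i)"
    by (simp add: sum_product[symmetric] sum_divide_distrib[symmetric])
  also have "\<dots> \<le> (\<Sum>i\<in>UNIV. ?D i i * p i) * 1"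
    using p Dnn pnn by (intro mult_left_mono sum_nonneg mult_nonneg_nonneg) auto
  finally show ?thesis
    by (simp add: left_diff_distrib sum_subtractf)
qed

text \<open>For a single increment the zeroth-order terms agree, the second-order terms are ordered
  by the quadratic comparison, and the two cubic errors remain.\<close>

lemma gauss_op_log_cosh_sum_step:
  fixes A B :: "real ^ 'n ^ 'n"
  assumes c: "c \<ge> 0" and D: "abs_increments_le (A ** transpose A) (B ** transpose B)"
  shows "gauss_op A (\<lambda>x. ennreal (log_cosh_sum c x)) x \<le> gauss_op B (\<lambda>x. ennreal (log_cosh_sum c x)) x
    + ennreal ((\<integral>z. norm (A *v z) ^ 3 \<partial>std_gaussian) + (\<integral>z. norm (B *v z) ^ 3 \<partial>std_gaussian))"
proof -
  let ?S = "c + (\<Sum>j\<in>UNIV. cosh (x $ j))"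
  have pos: "?S > 0"
    using hyp_moment_cosh_0_ge_1[of 0 x] c by (simp add: hyp_moment_def)
  have "(\<Sum>i\<in>UNIV. cosh (x $ i) / ?S) \<le> 1"
    using pos c by (simp add: sum_divide_distrib[symmetric])
  moreover have "\<bar>sinh (x $ i) / ?S\<bar> \<le> cosh (x $ i) / ?S" for i
    using pos abs_sinh_le_cosh[of "x $ i"] by (simp add: divide_right_mono)
  ultimately have quad: "(\<Sum>i\<in>UNIV. (A ** transpose A) $ i $ i * (cosh (x $ i) / ?S))
      - (\<Sum>i\<in>UNIV. \<Sum>j\<in>UNIV. (A ** transpose A) $ i $ j * (sinh (x $ i) / ?S * (sinh (x $ j) / ?S)))
    \<le> (\<Sum>i\<in>UNIV. (B ** transpose B) $ i $ i * (cosh (x $ i) / ?S))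
      - (\<Sum>i\<in>UNIV. \<Sum>j\<in>UNIV. (B ** transpose B) $ i $ j * (sinh (x $ i) / ?S * (sinh (x $ j) / ?S)))"
    by (intro abs_increments_le_quadratic[OF D]) auto
  have "a - (g + s / 2) \<le> e \<Longrightarrow> - (b - (g + t / 2)) \<le> f \<Longrightarrow> s \<le> t \<Longrightarrow> a \<le> b + (e + f)"
    for a b e f g s t :: real
    by linarith
  from this[OF abs_le_D1[OF log_cosh_sum_expectation(2)[OF c, of x A]]
      abs_le_D2[OF log_cosh_sum_expectation(2)[OF c, of x B]] quad]
  have "(\<integral>z. log_cosh_sum c (x + A *v z) \<partial>std_gaussian) \<le> (\<integral>z. log_cosh_sum c (x + B *v z) \<partial>std_gaussian)
     + ((\<integral>z. norm (A *v z) ^ 3 \<partial>std_gaussian) + (\<integral>z. norm (B *v z) ^ 3 \<partial>std_gaussian))" .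
  then show ?thesis
    unfolding gauss_op_def using c
    by (simp add: nn_integral_eq_integral log_cosh_sum_expectation(1) log_cosh_sum_nonneg
        ennreal_plus[symmetric] ennreal_leI del: ennreal_plus)
qed

text \<open>Each increment is cut into \<open>n\<close> pieces of scale
  \<open>d = 1 / sqrt n\<close>. One exchange costs \<open>d ^ 3 * K\<close>, all of them together
  \<open>d * K\<close>, which tends to 0.\<close>

lemma gauss_op_log_cosh_sum_mono:
  fixes A B :: "real ^ 'n ^ 'n"
  assumes c: "c \<ge> 0" and D: "abs_increments_le (A ** transpose A) (B ** transpose B)"
  shows "gauss_op A (\<lambda>x. ennreal (log_cosh_sum c x)) x \<le> gauss_op B (\<lambda>x. ennreal (log_cosh_sum c x)) x"
proof (rule ennreal_le_epsilon)
  let ?G = "\<lambda>x :: real ^ 'n. ennreal (log_cosh_sum c x)"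
  define K where "K = (\<integral>z. norm (A *v z) ^ 3 \<partial>std_gaussian) + (\<integral>z. norm (B *v z) ^ 3 \<partial>std_gaussian)"
  have "K \<ge> 0"
    unfolding K_def by simp
  fix e :: real assume "e > 0"
  \<comment> \<open>Exceeding \<open>(K / e)^2\<close> makes \<open>d * K \<le> e\<close>; the
    maximum with 1 ensures \<open>n > 0\<close>.\<close>
  obtain n where n: "(K / e)\<^sup>2 < real n" "n > 0"
    using reals_Archimedean2[of "max ((K / e)\<^sup>2) 1"] by (metis gr0I max_less_iff_conj not_one_less_zero of_nat_0)
  define d where "d = 1 / sqrt n"
  have d: "d > 0" "sqrt n * d = 1" "real n * d ^ 3 = d"
    using n by (auto simp: d_def power3_eq_cube field_simps)
  have Dd: "abs_increments_le ((d *\<^sub>R A) ** transpose (d *\<^sub>R A)) ((d *\<^sub>R B) ** transpose (d *\<^sub>R B))"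
    by (rule abs_increments_le_scaleR[OF D])
  have norm3: "(\<integral>z. norm ((d *\<^sub>R C) *v z) ^ 3 \<partial>std_gaussian) = d ^ 3 * (\<integral>z. norm (C *v z) ^ 3 \<partial>std_gaussian)"
    for C :: "real ^ 'n ^ 'n"
    using d by (simp add: scaleR_matrix_vector_assoc[symmetric] power_mult_distrib)
  have "(gauss_op (d *\<^sub>R A) ^^ n) ?G x \<le> (gauss_op (d *\<^sub>R B) ^^ n) ?G x + of_nat n * ennreal (d ^ 3 * K)"
  proof (rule gauss_op_power_le)
    show "gauss_op (d *\<^sub>R A) ?G x \<le> gauss_op (d *\<^sub>R B) ?G x + ennreal (d ^ 3 * K)" for x
      using gauss_op_log_cosh_sum_step[OF c Dd, of x] by (simp add: norm3 K_def distrib_left)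
  qed measurable
  also have "of_nat n * ennreal (d ^ 3 * K) = ennreal (d * K)"
    using d \<open>K \<ge> 0\<close> by (simp add: ennreal_of_nat_eq_real_of_nat ennreal_mult[symmetric] mult.assoc[symmetric])
  also have "d * K \<le> e"
  proof -
    have "K / e \<le> sqrt n"
      using n by (intro real_le_rsqrt) auto
    then show ?thesis
      using \<open>e > 0\<close> n by (simp add: d_def field_simps)
  qed
  finally show "gauss_op A ?G x \<le> gauss_op B ?G x + ennreal e"
    using d by (simp add: gauss_op_power ennreal_leI add_left_mono)
qed

section \<open>From the smoothed maximum to moments\<close>

lemma infnorm_eq_Max_cart: "infnorm (x :: real ^ 'n) = (MAX i\<in>UNIV. \<bar>x $ i\<bar>)"
  by (simp add: infnorm_Max Basis_real_vec image_image inner_axis)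

lemma infnorm_attained: obtains i where "infnorm (x :: real ^ 'n) = \<bar>x $ i\<bar>"
proof -
  have "Max (range (\<lambda>i. \<bar>x $ i\<bar>)) \<in> range (\<lambda>i. \<bar>x $ i\<bar>)"
    by (rule Max_in) auto
  then obtain i where "Max (range (\<lambda>i. \<bar>x $ i\<bar>)) = \<bar>x $ i\<bar>"
    by blast
  then show ?thesis
    by (intro that) (simp add: infnorm_eq_Max_cart)
qed

lemma borel_measurable_infnorm [measurable]: "infnorm \<in> borel_measurable (borel :: (real ^ 'n) measure)"
  by (intro borel_measurable_continuous_onI continuous_on_infnorm continuous_on_id)

text \<open>Since \<open>exp \<bar>y\<bar> \<le> 2 * cosh y\<close> and \<open>exp (b * t)\<close>
  is itself a summand, the exponential of the left-hand side is at most twice the argument of the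
  logarithm; hence \<open>ln 2\<close>.\<close>

lemma log_cosh_sum_ge_max:
  fixes x :: "real ^ 'n"
  assumes "b > 0"
  shows "b * max (infnorm x) t \<le> log_cosh_sum (exp (b * t)) (b *\<^sub>R x) + ln 2"
proof -
  obtain i where i: "infnorm x = \<bar>x $ i\<bar>"
    by (rule infnorm_attained)
  let ?S = "\<Sum>j\<in>UNIV. cosh (b * x $ j)"
  have S: "cosh (b * x $ i) \<le> ?S"
    by (intro member_le_sum) auto
  have "exp \<bar>b * x $ i\<bar> / 2 \<le> cosh (b * x $ i)"
    by (auto simp: cosh_field_def abs_if)
  then have infnorm_le: "exp (b * infnorm x) \<le> 2 * ?S"
    using S assms by (simp add: i abs_mult)
  have "?S \<ge> 0"
    by (intro sum_nonneg) auto
  have max_le: "exp (b * max (infnorm x) t) \<le> 2 * (exp (b * t) + ?S)"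
  proof (cases "infnorm x \<le> t")
    case True
    have "0 \<le> y \<Longrightarrow> 0 \<le> s \<Longrightarrow> y \<le> 2 * (y + s)" for y s :: real
      by (simp add: distrib_left)
    then show ?thesis
      unfolding max_absorb2[OF True] using \<open>?S \<ge> 0\<close> by simp
  next
    case False
    then have "max (infnorm x) t = infnorm x"
      by simp
    then show ?thesis
      using infnorm_le by (simp add: add_increasing)
  qed
  have "exp (b * t) + ?S > 0"
    using \<open>?S \<ge> 0\<close> by (intro add_pos_nonneg) auto
  with max_le have "b * max (infnorm x) t \<le> ln (2 * (exp (b * t) + ?S))"
    by (subst ln_ge_iff) auto
  also have "\<dots> = ln 2 + ln (exp (b * t) + ?S)"
    using \<open>exp (b * t) + ?S > 0\<close> by (intro ln_mult_pos) auto
  finally show ?thesis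
    by (simp add: log_cosh_sum_def add.commute)
qed

text \<open>Each of the \<open>1 + CARD('n)\<close> summands is at most
  \<open>exp (b * max (infnorm x) t)\<close>.\<close>

lemma log_cosh_sum_le_max:
  fixes x :: "real ^ 'n"
  assumes "b > 0"
  shows "log_cosh_sum (exp (b * t)) (b *\<^sub>R x) \<le> b * max (infnorm x) t + ln (1 + CARD('n))"
proof -
  let ?S = "\<Sum>j\<in>UNIV. cosh (b * x $ j)" and ?E = "exp (b * max (infnorm x) t)"
  have "cosh (b * x $ j) \<le> ?E" for j
  proof -
    have "cosh (b * x $ j) \<le> exp \<bar>b * x $ j\<bar>"
      by (auto simp: cosh_field_def abs_if)
    also have "\<bar>b * x $ j\<bar> \<le> b * max (infnorm x) t"
      using assms component_le_infnorm_cart[of x j] by (simp add: abs_mult)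
    finally show ?thesis by simp
  qed
  then have "?S \<le> of_nat CARD('n) * ?E"
    by (intro sum_bounded_above)
  moreover have "exp (b * t) \<le> ?E"
    using assms by simp
  ultimately have le: "exp (b * t) + ?S \<le> (1 + real CARD('n)) * ?E"
    unfolding distrib_right mult_1_left by (intro add_mono)
  have "?S \<ge> 0"
    by (intro sum_nonneg) auto
  then have "exp (b * t) + ?S > 0"
    by (intro add_pos_nonneg) auto
  with le have "ln (exp (b * t) + ?S) \<le> ln ((1 + real CARD('n)) * ?E)"
    by (subst ln_le_cancel_iff) auto
  also have "\<dots> = ln (1 + real CARD('n)) + b * max (infnorm x) t"
    by (subst ln_mult) auto
  finally show ?thesis by (simp add: log_cosh_sum_def)
qed

text \<open>After division by \<open>b\<close> the smoothed maximum differs from the true one by at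
  most a constant times \<open>1 / b\<close>, so the comparison survives with arbitrarily small
  error.\<close>

lemma nn_integral_max_infnorm_mono:
  fixes A B :: "real ^ 'n ^ 'n"
  assumes D: "abs_increments_le (A ** transpose A) (B ** transpose B)" and t: "t \<ge> 0"
  shows "(\<integral>\<^sup>+z. ennreal (max (infnorm (A *v z)) t) \<partial>std_gaussian)
       \<le> (\<integral>\<^sup>+z. ennreal (max (infnorm (B *v z)) t) \<partial>std_gaussian)"
proof (rule ennreal_le_epsilon)
  fix e :: real assume e: "e > 0"
  \<comment> \<open>\<open>L\<close> collects the lower and upper smoothing errors, and
    \<open>b\<close> is chosen to make their total \<open>L / b\<close> equal to
    \<open>e\<close>.\<close>
  define L where "L = ln (1 + CARD('n)) + ln 2"
  have L: "L > 0"
    unfolding L_def by (intro add_pos_pos) auto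
  define b where "b = L / e"
  have b: "b > 0" "L / b = e"
    using L e by (auto simp: b_def)
  let ?G = "\<lambda>x :: real ^ 'n. ennreal (log_cosh_sum (exp (b * t)) x)"
  let ?I = "\<lambda>C :: real ^ 'n ^ 'n. \<integral>\<^sup>+z. ennreal (max (infnorm (C *v z)) t) \<partial>std_gaussian"
  have nn: "0 \<le> max (infnorm x) t" for x :: "real ^ 'n"
    using t by simp
  have Gb: "gauss_op (b *\<^sub>R C) ?G 0 = (\<integral>\<^sup>+z. ?G (b *\<^sub>R (C *v z)) \<partial>std_gaussian)" for C :: "real ^ 'n ^ 'n"
    by (simp add: gauss_op_def scaleR_matrix_vector_assoc[symmetric])
  have I: "ennreal b * ?I C = (\<integral>\<^sup>+z. ennreal (b * max (infnorm (C *v z)) t) \<partial>std_gaussian)" for C :: "real ^ 'n ^ 'n"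
    using b nn by (simp add: nn_integral_cmult[symmetric] ennreal_mult)
  have add: "(\<integral>\<^sup>+z. f z + ennreal c \<partial>std_gaussian) = (\<integral>\<^sup>+z. f z \<partial>std_gaussian) + ennreal c"
    if [measurable]: "f \<in> borel_measurable borel" for f :: "real ^ 'n \<Rightarrow> ennreal" and c
    by (subst nn_integral_add) (auto simp: std_gaussian.emeasure_space_1[simplified])
  have Db: "abs_increments_le ((b *\<^sub>R A) ** transpose (b *\<^sub>R A)) ((b *\<^sub>R B) ** transpose (b *\<^sub>R B))"
    by (rule abs_increments_le_scaleR[OF D])
  have "ennreal b * ?I A \<le> (\<integral>\<^sup>+z. ?G (b *\<^sub>R (A *v z)) + ennreal (ln 2) \<partial>std_gaussian)"
    unfolding I using log_cosh_sum_ge_max[OF b(1)]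
    by (intro nn_integral_mono) (simp add: ennreal_plus[symmetric] log_cosh_sum_nonneg ennreal_leI del: ennreal_plus)
  also have "\<dots> = gauss_op (b *\<^sub>R A) ?G 0 + ennreal (ln 2)"
    unfolding Gb by (rule add) measurable
  also have "\<dots> \<le> gauss_op (b *\<^sub>R B) ?G 0 + ennreal (ln 2)"
    by (intro add_right_mono gauss_op_log_cosh_sum_mono Db) auto
  also have "gauss_op (b *\<^sub>R B) ?G 0
      \<le> (\<integral>\<^sup>+z. ennreal (b * max (infnorm (B *v z)) t) + ennreal (ln (1 + CARD('n))) \<partial>std_gaussian)"
    unfolding Gb using log_cosh_sum_le_max[OF b(1)] b nn
    by (intro nn_integral_mono) (simp add: ennreal_plus[symmetric] ennreal_leI del: ennreal_plus)
  also have "\<dots> = ennreal b * ?I B + ennreal (ln (1 + CARD('n)))"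
    unfolding I by (rule add) measurable
  finally have "ennreal b * ?I A \<le> ennreal b * ?I B + ennreal L"
    by (simp add: L_def ennreal_plus add.assoc)
  then have "ennreal (1 / b) * (ennreal b * ?I A) \<le> ennreal (1 / b) * (ennreal b * ?I B + ennreal L)"
    by (intro mult_left_mono) auto
  moreover have "ennreal (1 / b) * ennreal b = 1" "ennreal (1 / b) * ennreal L = ennreal e"
    using b L by (auto simp: ennreal_mult[symmetric])
  ultimately show "?I A \<le> ?I B + ennreal e"
    by (simp add: distrib_left mult.assoc[symmetric])
qed

text \<open>\<open>ennreal\<close> sends negative reals to 0, so \<open>ennreal (u - t)\<close> is
  the positive part and \<open>max u t\<close> is \<open>t\<close> plus it; the finite constant
  \<open>t\<close> cancels.\<close>

lemma nn_integral_infnorm_excess_mono: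
  fixes A B :: "real ^ 'n ^ 'n"
  assumes D: "abs_increments_le (A ** transpose A) (B ** transpose B)" and t: "t \<ge> 0"
  shows "(\<integral>\<^sup>+z. ennreal (infnorm (A *v z) - t) \<partial>std_gaussian)
       \<le> (\<integral>\<^sup>+z. ennreal (infnorm (B *v z) - t) \<partial>std_gaussian)"
proof -
  have "ennreal (max u t) = ennreal t + ennreal (u - t)" for u
    using t by (auto simp: max_def ennreal_plus[symmetric] ennreal_neg simp del: ennreal_plus)
  then have "(\<integral>\<^sup>+z. ennreal (max (infnorm (C *v z)) t) \<partial>std_gaussian)
      = ennreal t + (\<integral>\<^sup>+z. ennreal (infnorm (C *v z) - t) \<partial>std_gaussian)" for C :: "real ^ 'n ^ 'n"
    by (simp add: nn_integral_add std_gaussian.emeasure_space_1[simplified])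
  then show ?thesis
    using nn_integral_max_infnorm_mono[OF D t] by simp
qed

text \<open>Taylor's formula at 0 with integral remainder; the positive part
  \<open>ennreal (u - t)\<close> cuts the integral off at \<open>u\<close>.\<close>

lemma powr_eq_nn_integral_excess:
  assumes m: "m > 1" and "u \<ge> 0"
  shows "ennreal (u powr m)
    = (\<integral>\<^sup>+t. ennreal (indicator {0<..} t * (m * (m - 1) * t powr (m - 2))) * ennreal (u - t) \<partial>lborel)"
proof (cases "u = 0")
  case True
  have "(\<lambda>t :: real. ennreal (indicator {0<..} t * (m * (m - 1) * t powr (m - 2))) * ennreal (0 - t)) = (\<lambda>t. 0)"
    by (rule ext, rename_tac t, case_tac "t > 0") (auto simp: ennreal_neg)
  then show ?thesis
    unfolding True by simp
next
  case False
  then have u: "u > 0" using assms by simp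
  \<comment> \<open>An antiderivative of \<open>?f\<close> with limit 0 at 0 and value
    \<open>u powr m\<close> at \<open>u\<close>.\<close>
  let ?F = "\<lambda>t. m * u * t powr (m - 1) - (m - 1) * t powr m"
  let ?f = "\<lambda>t. m * (m - 1) * t powr (m - 2) * (u - t)"
  have F: "(?F has_field_derivative ?f t) (at t)" if "t > 0" for t
  proof -
    have "t powr (m - 1) = t * t powr (m - 2)"
      using that powr_mult_base[of t "m - 2"] by simp
    moreover have "m - 1 - 1 = m - 2" by simp
    ultimately show ?thesis
      using that by (auto intro!: derivative_eq_intros simp: algebra_simps)
  qed
  have lim: "(?F \<longlongrightarrow> 0) (at_right 0)"
  proof -
    have "((\<lambda>t. t powr p) \<longlongrightarrow> 0) (at_right (0::real))" if "p > 0" for p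
      using that by (intro tendsto_zero_powrI[where b=p]) (auto simp: eventually_at_right_less eventually_at_filter)
    then have "(?F \<longlongrightarrow> m * u * 0 - (m - 1) * 0) (at_right 0)"
      using m by (intro tendsto_intros) auto
    then show ?thesis by simp
  qed
  have limu: "(?F \<longlongrightarrow> u powr m) (at_left u)"
  proof -
    have "isCont ?F u"
      using F[OF u] by (rule DERIV_isCont)
    moreover have "?F u = u powr m"
      using powr_mult_base[of u "m - 1"] u by (simp add: algebra_simps)
    ultimately show ?thesis
      by (simp add: isCont_def filterlim_at_split)
  qed
  have cont: "isCont ?f t" if "0 < ereal t" for t
    using that by (intro continuous_intros) auto
  have nonneg: "AE t in lborel. 0 < ereal t \<longrightarrow> ereal t < ereal u \<longrightarrow> 0 \<le> ?f t"
    using m by auto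
  have lim0: "((?F \<circ> real_of_ereal) \<longlongrightarrow> 0) (at_right 0)"
    using lim by (simp add: ereal_tendsto_simps zero_ereal_def)
  have limu': "((?F \<circ> real_of_ereal) \<longlongrightarrow> u powr m) (at_left (ereal u))"
    using limu by (simp add: ereal_tendsto_simps)
  \<comment> \<open>For \<open>m < 2\<close> the integrand is unbounded near 0, hence the
    fundamental theorem on the open interval: nonnegativity and the one-sided limits of
    \<open>?F\<close> give integrability as well as the value.\<close>
  note FTC = interval_integral_FTC_nonneg[where a=0 and b="ereal u" and F="?F" and f="?f",
      OF _ _ cont nonneg lim0 limu']
  have FTC1: "set_integrable lborel (einterval 0 (ereal u)) ?f"
    using u F by (intro FTC(1)) auto
  have FTC2: "(LBINT t=0..ereal u. ?f t) = u powr m - 0"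
    using u F by (intro FTC(2)) auto
  have set: "einterval 0 (ereal u) = {0<..<u}"
    by (auto simp: einterval_def)
  have "(\<integral>\<^sup>+t. ennreal (indicator {0<..} t * (m * (m - 1) * t powr (m - 2))) * ennreal (u - t) \<partial>lborel)
      = (\<integral>\<^sup>+t. ennreal (indicator {0<..<u} t *\<^sub>R ?f t) \<partial>lborel)"
  proof (rule nn_integral_cong)
    show "ennreal (indicator {0<..} t * (m * (m - 1) * t powr (m - 2))) * ennreal (u - t)
        = ennreal (indicator {0<..<u} t *\<^sub>R ?f t)" for t
    proof (cases "0 < t \<and> t < u")
      case True
      then show ?thesis using m by (simp add: ennreal_mult[symmetric])
    next
      case False
      then show ?thesis by (auto simp: indicator_def ennreal_neg)
    qed
  qed
  also have "\<dots> = ennreal (\<integral>t. indicator {0<..<u} t *\<^sub>R ?f t \<partial>lborel)"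
    using FTC1 m by (intro nn_integral_eq_integral) (auto simp: set set_integrable_def indicator_def)
  also have "\<dots> = ennreal (u powr m)"
    using FTC2 u by (simp add: interval_lebesgue_integral_def set set_lebesgue_integral_def)
  finally show ?thesis by simp
qed

text \<open>Tonelli moves the expectation inside the mixture, where the excesses are compared for
  each threshold under a nonnegative weight.\<close>

lemma nn_integral_infnorm_powr_mono:
  fixes A B :: "real ^ 'n ^ 'n"
  assumes D: "abs_increments_le (A ** transpose A) (B ** transpose B)" and m: "m \<ge> 1"
  shows "(\<integral>\<^sup>+z. ennreal (infnorm (A *v z) powr m) \<partial>std_gaussian)
       \<le> (\<integral>\<^sup>+z. ennreal (infnorm (B *v z) powr m) \<partial>std_gaussian)"
proof (cases "m = 1")
  \<comment> \<open>The weight \<open>m * (m - 1)\<close> vanishes here, so the mixture says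
    nothing; the first moment is the excess over 0.\<close>
  case True
  then show ?thesis
    using nn_integral_infnorm_excess_mono[OF D, of 0] by (simp add: infnorm_pos_le)
next
  case False
  then have m: "m > 1" using m by simp
  interpret lg: pair_sigma_finite lborel "std_gaussian :: (real ^ 'n) measure" ..
  let ?w = "\<lambda>t :: real. ennreal (indicator {0<..} t * (m * (m - 1) * t powr (m - 2)))"
  have eq: "(\<integral>\<^sup>+z. ennreal (infnorm (C *v z) powr m) \<partial>std_gaussian)
      = (\<integral>\<^sup>+t. ?w t * (\<integral>\<^sup>+z. ennreal (infnorm (C *v z) - t) \<partial>std_gaussian) \<partial>lborel)"
    for C :: "real ^ 'n ^ 'n"
  proof -
    have "(\<integral>\<^sup>+z. ennreal (infnorm (C *v z) powr m) \<partial>std_gaussian)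
      = (\<integral>\<^sup>+z. \<integral>\<^sup>+t. ?w t * ennreal (infnorm (C *v z) - t) \<partial>lborel \<partial>std_gaussian)"
      by (simp add: powr_eq_nn_integral_excess[OF m] infnorm_pos_le)
    also have "\<dots> = (\<integral>\<^sup>+t. \<integral>\<^sup>+z. ?w t * ennreal (infnorm (C *v z) - t) \<partial>std_gaussian \<partial>lborel)"
      by (rule lg.Fubini') measurable
    finally show ?thesis
      by (simp add: nn_integral_cmult)
  qed
  show ?thesis
    unfolding eq
  proof (rule nn_integral_mono)
    show "?w t * (\<integral>\<^sup>+z. ennreal (infnorm (A *v z) - t) \<partial>std_gaussian)
        \<le> ?w t * (\<integral>\<^sup>+z. ennreal (infnorm (B *v z) - t) \<partial>std_gaussian)" for t
      using nn_integral_infnorm_excess_mono[OF D, of t]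
      \<comment> \<open>For \<open>t \<le> 0\<close> the weight is 0.\<close>
      by (cases "t > 0") (auto intro!: mult_left_mono)
  qed
qed

text \<open>Guards the passage to real expectations, where an infinite right-hand side would be read
  as 0.\<close>

lemma nn_integral_infnorm_powr_finite:
  fixes B :: "real ^ 'n ^ 'n"
  assumes m: "m \<ge> 0"
  shows "(\<integral>\<^sup>+z. ennreal (infnorm (B *v z) powr m) \<partial>std_gaussian) < \<infinity>"
proof -
  \<comment> \<open>Rounding up reduces to integer moments above 1; below 1 the power is at most 1,
    whence the added constant.\<close>
  define p where "p = nat \<lceil>m\<rceil>"
  have p: "m \<le> real p"
    using m by (simp add: p_def)
  have "(\<integral>\<^sup>+z. ennreal (infnorm (B *v z) powr m) \<partial>std_gaussian)
      \<le> (\<integral>\<^sup>+z. ennreal (1 + norm (B *v z) ^ p) \<partial>std_gaussian)"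
  proof (intro nn_integral_mono ennreal_leI)
    fix z
    let ?u = "infnorm (B *v z)"
    show "?u powr m \<le> 1 + norm (B *v z) ^ p"
    proof (cases "?u \<le> 1")
      case True
      then have "?u powr m \<le> 1"
        using m by (intro powr_le1) (auto simp: infnorm_pos_le)
      then show ?thesis
        using zero_le_power[OF norm_ge_zero[of "B *v z"], of p] by linarith
    next
      case False
      then have "?u powr m \<le> ?u powr real p"
        using p by (intro powr_mono) auto
      also have "\<dots> = ?u ^ p"
        using False by (intro powr_realpow) auto
      also have "\<dots> \<le> norm (B *v z) ^ p"
        by (intro power_mono infnorm_le_norm infnorm_pos_le)
      finally show ?thesis by simp
    qed
  qed
  also have "\<dots> < \<infinity>"
    by (subst nn_integral_eq_integral)
      (auto intro!: Bochner_Integration.integrable_add integrable_std_gaussian_linear_norm)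
  finally show ?thesis .
qed

lemma nn_integral_centered_normal:
  fixes X :: "'a \<Rightarrow> real ^ 'n" and A :: "real ^ 'n ^ 'n"
  assumes X: "X \<in> borel_measurable M"
    and distr: "distr M borel X = distr std_gaussian borel (\<lambda>z. A *v z)"
    and [measurable]: "f \<in> borel_measurable borel"
  shows "(\<integral>\<^sup>+\<omega>. f (X \<omega>) \<partial>M) = (\<integral>\<^sup>+z. f (A *v z) \<partial>std_gaussian)"
proof -
  have "(\<integral>\<^sup>+\<omega>. f (X \<omega>) \<partial>M) = (\<integral>\<^sup>+x. f x \<partial>(distr M borel X))"
    using X by (simp add: nn_integral_distr)
  also have "\<dots> = (\<integral>\<^sup>+z. f (A *v z) \<partial>std_gaussian)"
    unfolding distr by (subst nn_integral_distr) auto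
  finally show ?thesis .
qed

theorem theorem1:
  fixes M :: "'a measure" and N :: "'b measure"
    and X :: "'a \<Rightarrow> real ^ 'k" and Y :: "'b \<Rightarrow> real ^ 'k"
    and SX SY :: "real ^ 'k ^ 'k" and m :: real
  assumes "prob_space M" and "prob_space N"
    and "covariance_matrix SX" and "covariance_matrix SY"
    and "X \<in> borel_measurable M" and "is_centered_normal (distr M borel X) SX"
    and "Y \<in> borel_measurable N" and "is_centered_normal (distr N borel Y) SY"
    and "\<And>i j. 2 * \<bar>SX $ i $ j - SY $ i $ j\<bar>
           \<le> SY $ i $ i - SX $ i $ i + SY $ j $ j - SX $ j $ j"
    and "m \<ge> 1"
  shows "prob_space.expectation M (\<lambda>\<omega>. (MAX i\<in>UNIV. \<bar>X \<omega> $ i\<bar>) powr m)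
       \<le> prob_space.expectation N (\<lambda>\<omega>. (MAX i\<in>UNIV. \<bar>Y \<omega> $ i\<bar>) powr m)"
proof -
  note [measurable] = assms(5,7)
  obtain A :: "real ^ 'k ^ 'k" where A: "A ** transpose A = SX" "distr M borel X = distr std_gaussian borel (\<lambda>z. A *v z)"
    using assms(6) unfolding is_centered_normal_def by blast
  obtain B :: "real ^ 'k ^ 'k" where B: "B ** transpose B = SY" "distr N borel Y = distr std_gaussian borel (\<lambda>z. B *v z)"
    using assms(8) unfolding is_centered_normal_def by blast
  have D: "abs_increments_le (A ** transpose A) (B ** transpose B)"
    using assms(9) unfolding abs_increments_le_def A B by blast
  have "(\<integral>\<^sup>+\<omega>. ennreal (infnorm (X \<omega>) powr m) \<partial>M) = (\<integral>\<^sup>+z. ennreal (infnorm (A *v z) powr m) \<partial>std_gaussian)"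
    by (rule nn_integral_centered_normal[OF assms(5) A(2)]) measurable
  moreover have "(\<integral>\<^sup>+\<omega>. ennreal (infnorm (Y \<omega>) powr m) \<partial>N) = (\<integral>\<^sup>+z. ennreal (infnorm (B *v z) powr m) \<partial>std_gaussian)"
    by (rule nn_integral_centered_normal[OF assms(7) B(2)]) measurable
  \<comment> \<open>Both expectations are \<open>enn2real\<close> of the nonnegative integrals; that
    map is monotone below a finite bound, supplied by the finite moment of \<open>Y\<close>.\<close>
  ultimately have "(\<integral>\<omega>. infnorm (X \<omega>) powr m \<partial>M) \<le> (\<integral>\<omega>. infnorm (Y \<omega>) powr m \<partial>N)"
    using nn_integral_infnorm_powr_mono[OF D assms(10)] nn_integral_infnorm_powr_finite[of m B] assms(10)
    by (simp add: integral_eq_nn_integral enn2real_mono)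
  then show ?thesis
    by (simp add: infnorm_eq_Max_cart)
qed

end
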